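(* For every $n\ge1$, every $\mathbf{x}\in S$ and every $k\in\{1,\dots,n+1\}$, the $n\times n$ matrix $$Q_k=\left[\frac{P_i'(x_j)}{x_j-z_i}\right]_{i\in\{1,\dots,n+1\}\setminus\{k\};\ j\in\{1,\dots,n\}}$$ is nonsingular.
   Context: Let $S=\{\mathbf{x}=(x_1,\dots,x_n)\in\mathbb{R}^n: 0<x_1<\dots<x_n<\infty\}$, $x_0:=0$, $I_k:=[x_{k-1},x_k]$ for $k=1,\dots,n$ and $I_{n+1}:=[x_n,\infty)$. Let $$h_k(t)=\frac{e^{-t}}{e^{-x_k}}\prod_{l=0,\,l\ne k}^n\frac{t-x_l}{x_k-x_l}\quad(k=0,\dots,n),\qquad h_{n+1}=1-\sum_{k=0}^n h_k.$$ The Lebesgue function is $L(t)=\sum_{k=0}^{n+1}|h_k(t)|$. For $i=1,\dots,n+1$, $P_i$ is the function on $\mathbb{R}$ of the form $e^{-t}p(t)+c$ ($p$ a real polynomial of degree at most $n$, $c\in\mathbb{R}$) which agrees with $L$ on $I_i$; explicitly $P_i=\sum_{k=0}^{n+1}\varepsilon_{k,i}h_k$ with $\varepsilon_{k,i}=(-1)^{k-i}$ if $i\le k$ and $\varepsilon_{k,i}=(-1)^{k+1-i}$ if $i>k$. $P_i'$ denotes the derivative with respect to $t$. $z_i=z_i(\mathbf{x})$ is the (unique, interior) point of $I_i$ at which $P_i$ attains its maximum on $I_i$. *)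

theory Defs
  imports "HOL-Analysis.Derivative" "Jordan_Normal_Form.Determinant"
begin

text \<open>
  A point of \<open>S\<close> is represented by a function \<open>x :: nat \<Rightarrow> real\<close> whose values at
  \<open>1, \<dots>, n\<close> are the coordinates; the convention \<open>x\<^sub>0 = 0\<close> is part of the definition,
  so that \<open>0 < x\<^sub>1\<close> is the case \<open>k = 0\<close> of the chain. Values beyond \<open>n\<close> are unconstrained
  and never used.
\<close>

definition node_simplex :: "nat \<Rightarrow> (nat \<Rightarrow> real) set" where
  "node_simplex n = {x. x 0 = 0 \<and> (\<forall>k<n. x k < x (Suc k))}"

definition node_interval :: "nat \<Rightarrow> (nat \<Rightarrow> real) \<Rightarrow> nat \<Rightarrow> real set" where
  "node_interval n x i = (if i \<le> n then {x (i - 1)..x i} else {x n..})"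

definition exp_lagrange :: "nat \<Rightarrow> (nat \<Rightarrow> real) \<Rightarrow> nat \<Rightarrow> real \<Rightarrow> real" where
  "exp_lagrange n x k t =
     exp (- t) / exp (- x k) * (\<Prod>l\<in>{0..n} - {k}. (t - x l) / (x k - x l))"

text \<open>The fundamental functions \<open>h\<^sub>k\<close>; the index \<open>n + 1\<close> belongs to the node at infinity.\<close>

definition fundamental :: "nat \<Rightarrow> (nat \<Rightarrow> real) \<Rightarrow> nat \<Rightarrow> real \<Rightarrow> real" where
  "fundamental n x k t =
     (if k \<le> n then exp_lagrange n x k t else 1 - (\<Sum>j=0..n. exp_lagrange n x j t))"

definition lebesgue_sign :: "nat \<Rightarrow> nat \<Rightarrow> real" where
  "lebesgue_sign k i =
     (if i \<le> k then (-1) powi (int k - int i) else (-1) powi (int k + 1 - int i))"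

text \<open>
  For \<open>x \<in> node_simplex n\<close>, \<open>i \<in> {1..n+1}\<close> and \<open>t \<in> node_interval n x i\<close>, this agrees with the
  Lebesgue function \<open>\<Sum>k=0..n+1. \<bar>fundamental n x k t\<bar>\<close>, because there
  \<open>lebesgue_sign k i * fundamental n x k t \<ge> 0\<close>.
\<close>

definition lebesgue_piece :: "nat \<Rightarrow> (nat \<Rightarrow> real) \<Rightarrow> nat \<Rightarrow> real \<Rightarrow> real" where
  "lebesgue_piece n x i t = (\<Sum>k=0..n+1. lebesgue_sign k i * fundamental n x k t)"

text \<open>
  For \<open>x \<in> node_simplex n\<close> and \<open>i \<in> {1..n+1}\<close> the maximum over the interval is attained at
  exactly one point, and that point is interior; so \<open>THE\<close> is well defined there.
\<close>

definition max_point :: "nat \<Rightarrow> (nat \<Rightarrow> real) \<Rightarrow> nat \<Rightarrow> real" where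
  "max_point n x i =
     (THE z. is_arg_max (lebesgue_piece n x i) (\<lambda>t. t \<in> node_interval n x i) z)"

text \<open>
  Matrix positions start at 0: column \<open>b\<close> stands for \<open>j = b + 1\<close>. Since
  \<open>insert_index (k - 1)\<close> enumerates the naturals other than \<open>k - 1\<close> in increasing order, the
  rows run through \<open>i \<in> {1..n+1} - {k}\<close> in increasing order.
\<close>

definition Q_matrix :: "nat \<Rightarrow> (nat \<Rightarrow> real) \<Rightarrow> nat \<Rightarrow> real mat" where
  "Q_matrix n x k = mat n n (\<lambda>(a, b).
     let i = Suc (insert_index (k - 1) a); j = Suc b
     in deriv (lebesgue_piece n x i) (x j) / (x j - max_point n x i))"

end

theory Submission
  imports Defs
begin

text \<open>
  Every piece \<open>P\<^sub>i\<close> has the form \<open>e\<^sup>-\<^sup>t p(t) + c\<close> with \<open>p\<close> of degree at most \<open>n\<close>, so that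
  \<open>P\<^sub>i'(t) = e\<^sup>-\<^sup>t r\<^sub>i(t)\<close> with \<open>r\<^sub>i\<close> of degree at most \<open>n\<close>. Since \<open>z\<^sub>i\<close> is an interior maximum,
  \<open>r\<^sub>i(t) = (t - z\<^sub>i) q\<^sub>i(t)\<close>, and the entries of \<open>Q\<^sub>k\<close> are \<open>e\<^sup>-\<^sup>x q\<^sub>i(x)\<close> at \<open>x = x\<^sub>j\<close>. A polynomial
  of degree less than \<open>n\<close> is determined by its values at the \<open>n\<close> nodes, so \<open>Q\<^sub>k\<close> is nonsingular
  exactly if the \<open>n\<close> polynomials \<open>q\<^sub>i\<close> with \<open>i \<noteq> k\<close> are linearly independent.

  Independence is tested at the points \<open>z\<^sub>1 < \<dots> < z\<^sub>n\<^sub>+\<^sub>1\<close> instead of at the nodes. The key fact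
  (\<open>piece_slope_sign_at_max_point\<close>, \<open>slope_quotient_sign\<close>) is that \<open>q\<^sub>i(z\<^sub>j)\<close> has the sign
  \<open>(-1)\<^sup>i\<^sup>+\<^sup>j\<close> whenever \<open>i \<noteq> j\<close>. The divided difference of \<open>q\<^sub>i\<close> over all \<open>n + 1\<close> points \<open>z\<^sub>j\<close>
  vanishes, and its weights alternate in sign. In the matrix of the weighted values \<open>q\<^sub>i(z\<^sub>j)\<close> the
  off-diagonal entries of a row therefore share one strict sign while the row sums to zero.
  Deleting row and column \<open>k\<close> leaves a strictly diagonally dominant matrix, which is nonsingular
  by the maximum principle (\<open>sign_alternating_kernel_trivial\<close>).

  For the key fact suppose that \<open>P\<^sub>l'(z\<^sub>j)\<close> has the wrong sign. As \<open>P\<^sub>j\<close> dominates \<open>\<bar>P\<^sub>l\<bar>\<close> on \<open>I\<^sub>j\<close>, a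
  combination \<open>G = P\<^sub>l + \<nu> P\<^sub>j\<close> with \<open>\<bar>\<nu>\<bar> \<le> 1\<close> vanishes at \<open>z\<^sub>j\<close>; because \<open>P\<^sub>j'(z\<^sub>j) = 0\<close>, \<open>G\<close> still
  has the wrong slope there, and at the nodes, including infinity, it keeps the weak sign pattern
  of \<open>P\<^sub>l\<close>. The values of \<open>G\<close> at the nodes and at \<open>z\<^sub>j\<close> then make the sign of \<open>G'\<close> alternate weakly
  at \<open>n + 2\<close> points: one in every interval except \<open>I\<^sub>l\<close> and \<open>I\<^sub>j\<close>, and three in \<open>I\<^sub>j\<close>. This forces
  \<open>G' = 0\<close> (\<open>descent_in_other_interval_imp_0\<close>), although \<open>G\<close> takes different values at the two ends
  of \<open>I\<^sub>j\<close>. The same count with two points in \<open>I\<^sub>j\<close> for a function with the sign pattern of \<open>P\<^sub>j\<close>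
  (\<open>descent_in_own_interval_imp_0\<close>) yields the domination of \<open>\<bar>P\<^sub>l\<bar>\<close> by \<open>P\<^sub>j\<close> and the uniqueness of
  \<open>z\<^sub>j\<close>. Weak sign conditions suffice throughout because the divided difference
  of a polynomial of degree at most \<open>n\<close> at \<open>n + 2\<close> points vanishes, so terms of one weak sign
  must all be zero.
\<close>

section \<open>Divided differences and weakly alternating polynomials\<close>

text \<open>
  The sum is the leading coefficient of the Lagrange interpolant of \<open>q\<close> at the points \<open>z j\<close>,
  taken as a polynomial of degree \<open>card J - 1\<close>. The interpolant is \<open>q\<close> itself, whose degree is
  smaller.
\<close>

lemma divided_difference_eq_0:
  fixes q :: "real poly" and z :: "'a \<Rightarrow> real"
  assumes fin: "finite J" and inj: "inj_on z J" and deg: "degree q + 1 < card J"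
  shows "(\<Sum>j\<in>J. poly q (z j) / (\<Prod>i\<in>J - {j}. z j - z i)) = 0"
proof -
  define w where "w j = (\<Prod>i\<in>J - {j}. z j - z i)" for j
  define B where "B j = (\<Prod>i\<in>J - {j}. [:- z i, 1:])" for j
  define D where "D = (\<Sum>j\<in>J. smult (poly q (z j) / w j) (B j))"
  have w_nz: "w j \<noteq> 0" if "j \<in> J" for j
    using that inj fin by (auto simp: w_def inj_on_def)
  have degB: "degree (B j) = card J - 1" if "j \<in> J" for j
    unfolding B_def using that fin by (subst degree_prod_sum_eq) auto
  have leadB: "Polynomial.coeff (B j) (card J - 1) = 1" if "j \<in> J" for j
    using degB[OF that] lead_coeff_prod[of "\<lambda>i. [:- z i, 1:]" "J - {j}"]
    by (simp add: B_def)
  have polyB: "poly (B j) (z m) = (if m = j then w j else 0)" if "j \<in> J" "m \<in> J" for j m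
    using that fin by (auto simp: B_def w_def poly_prod)
  have "degree D \<le> card J - 1"
    unfolding D_def by (intro degree_sum_le fin) (use degB in auto)
  moreover have "card (z ` J) = card J"
    by (rule card_image[OF inj])
  moreover have "poly q y = poly D y" if y: "y \<in> z ` J" for y
  proof -
    obtain m where m: "m \<in> J" "y = z m"
      using y by blast
    have "poly D y = (\<Sum>j\<in>J. if m = j then poly q (z j) else 0)"
      unfolding D_def poly_sum by (rule sum.cong) (use m polyB w_nz in auto)
    then show ?thesis
      using m fin by simp
  qed
  ultimately have "q = D"
    using deg by (intro poly_eqI_degree[of "z ` J"]) auto
  then have "Polynomial.coeff D (card J - 1) = 0"
    using deg by (intro coeff_eq_0) simp
  moreover have "Polynomial.coeff D (card J - 1) = (\<Sum>j\<in>J. poly q (z j) / w j)"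
    unfolding D_def coeff_sum by (rule sum.cong) (use leadB in auto)
  ultimately show ?thesis
    by (simp add: w_def)
qed

lemma node_product_sign:
  fixes z :: "nat \<Rightarrow> real"
  assumes mono: "strict_mono_on {..N} z" and j: "j \<le> N"
  shows "0 < (-1) ^ (N + j) * (\<Prod>i\<in>{..N} - {j}. z j - z i)"
proof -
  have split: "{..N} - {j} = {..<j} \<union> {Suc j..N}"
    using j by auto
  have lower: "0 < (\<Prod>i<j. z j - z i)"
    using j by (intro prod_pos) (auto intro!: strict_mono_onD[OF mono])
  have upper: "0 < (\<Prod>i=Suc j..N. z i - z j)"
    using j by (intro prod_pos) (auto intro!: strict_mono_onD[OF mono])
  have "(\<Prod>i=Suc j..N. z j - z i) = (\<Prod>i=Suc j..N. (-1) * (z i - z j))"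
    by simp
  also have "\<dots> = (-1) ^ (N - j) * (\<Prod>i=Suc j..N. z i - z j)"
    by (subst prod.distrib) simp
  finally have "(\<Prod>i\<in>{..N} - {j}. z j - z i)
      = (-1) ^ (N - j) * ((\<Prod>i<j. z j - z i) * (\<Prod>i=Suc j..N. z i - z j))"
    unfolding split by (subst prod.union_disjoint) auto
  moreover have "(-1) ^ (N + j) * (-1) ^ (N - j) = (1 :: real)"
    using j by (simp flip: power_add)
  ultimately have "(-1) ^ (N + j) * (\<Prod>i\<in>{..N} - {j}. z j - z i)
      = (\<Prod>i<j. z j - z i) * (\<Prod>i=Suc j..N. z i - z j)"
    by (metis mult.assoc mult_1)
  then show ?thesis
    using lower upper by simp
qed

text \<open>
  The weights of the divided difference at \<open>n + 2\<close> increasing points alternate in sign, so all its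
  terms have one weak sign. As they add up to zero they all vanish, which gives \<open>r\<close> too many
  zeros.
\<close>

lemma weakly_alternating_imp_0:
  fixes r :: "real poly"
  assumes deg: "degree r \<le> n" and mono: "strict_mono_on {..Suc n} s"
    and alt: "\<And>i. i \<le> Suc n \<Longrightarrow> 0 \<le> (-1) ^ i * poly r (s i)"
  shows "r = 0"
proof -
  define w where "w i = (\<Prod>m\<in>{..Suc n} - {i}. s i - s m)" for i
  have inj: "inj_on s {..Suc n}"
    by (rule strict_mono_on_imp_inj_on[OF mono])
  have w: "0 < (-1) ^ (Suc n + i) * w i" if "i \<le> Suc n" for i
    unfolding w_def by (rule node_product_sign[OF mono that])
  have term_nonneg: "0 \<le> (-1) ^ Suc n * (poly r (s i) / w i)" if i: "i \<le> Suc n" for i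
  proof -
    have "(-1) ^ Suc n * (poly r (s i) / w i)
        = ((-1) ^ i * poly r (s i)) / ((-1) ^ (Suc n + i) * w i)"
      by (cases "even i"; cases "even n") simp_all
    then show ?thesis
      using alt[OF i] w[OF i] by (metis divide_nonneg_pos)
  qed
  have "(\<Sum>i\<le>Suc n. poly r (s i) / w i) = 0"
    unfolding w_def by (rule divided_difference_eq_0) (use inj deg in auto)
  then have "(\<Sum>i\<le>Suc n. (-1) ^ Suc n * (poly r (s i) / w i)) = 0"
    by (simp only: sum_distrib_left[symmetric] mult_zero_right)
  then have "\<forall>i\<in>{..Suc n}. (-1) ^ Suc n * (poly r (s i) / w i) = 0"
    using term_nonneg by (subst (asm) sum_nonneg_eq_0_iff) auto
  then have "poly r (s i) = 0" if "i \<le> Suc n" for i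
    using w[OF that] that by auto
  moreover have "card (s ` {..Suc n}) = n + 2"
    using card_image[OF inj] by simp
  ultimately show ?thesis
    using deg by (intro poly_eqI_degree[of "s ` {..Suc n}"]) auto
qed

text \<open>
  The form in which alternation occurs below: among \<open>n + 3\<close> points nothing is known at the one
  with index \<open>g\<close>, and the sign pattern is shifted by one step across this gap.
\<close>

lemma weakly_alternating_gap_imp_0:
  fixes r :: "real poly"
  assumes deg: "degree r \<le> n" and mono: "strict_mono_on {..n + 2} v" and g: "g \<le> n + 2"
    and below: "\<And>i. i < g \<Longrightarrow> 0 \<le> \<tau> * (-1) ^ i * poly r (v i)"
    and above: "\<And>i. g < i \<Longrightarrow> i \<le> n + 2 \<Longrightarrow> \<tau> * (-1) ^ i * poly r (v i) \<le> 0"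
    and \<tau>: "\<tau> \<noteq> 0"
  shows "r = 0"
proof -
  define s where "s i = v (if i < g then i else Suc i)" for i
  have "smult \<tau> r = 0"
  proof (rule weakly_alternating_imp_0)
    show "degree (smult \<tau> r) \<le> n"
      using deg by simp
    show "strict_mono_on {..Suc n} s"
    proof (rule strict_mono_onI)
      fix i k assume "i \<in> {..Suc n}" "k \<in> {..Suc n}" "i < k"
      then show "s i < s k"
        unfolding s_def by (intro strict_mono_onD[OF mono]) auto
    qed
    fix i assume i: "i \<le> Suc n"
    show "0 \<le> (-1) ^ i * poly (smult \<tau> r) (s i)"
      using below[of i] above[of "Suc i"] i by (cases "i < g") (auto simp: s_def mult_ac)
  qed
  then show ?thesis
    using \<tau> by simp
qed

section \<open>Exponential polynomials\<close>

definition exp_poly :: "real poly \<Rightarrow> real \<Rightarrow> real \<Rightarrow> real" where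
  "exp_poly p c t = exp (- t) * poly p t + c"

definition slope_poly :: "real poly \<Rightarrow> real poly" where
  "slope_poly p = pderiv p - p"

lemma exp_poly_has_derivative:
  "(exp_poly p c has_real_derivative exp (- t) * poly (slope_poly p) t) (at t)"
  unfolding exp_poly_def slope_poly_def
  by (auto intro!: derivative_eq_intros simp: algebra_simps)

lemma continuous_on_exp_poly: "continuous_on A (exp_poly p c)"
  unfolding exp_poly_def by (intro continuous_intros)

lemma degree_slope_poly: "degree p \<le> n \<Longrightarrow> degree (slope_poly p) \<le> n"
  unfolding slope_poly_def by (rule degree_diff_le) (simp_all add: degree_pderiv)

lemma slope_poly_eq_0_iff [simp]: "slope_poly p = 0 \<longleftrightarrow> p = 0"
proof
  assume "slope_poly p = 0"
  then have eq: "pderiv p = p"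
    by (simp add: slope_poly_def)
  then have "degree p = 0"
    using degree_pderiv[of p] by simp
  then show "p = 0"
    using eq pderiv_eq_0_iff[of p] by simp
qed (simp add: slope_poly_def)

lemma slope_poly_lincomb:
  "slope_poly (smult a p + smult b q) = smult a (slope_poly p) + smult b (slope_poly q)"
  by (simp add: slope_poly_def pderiv_add pderiv_smult smult_diff_right)

lemma exp_poly_tendsto: "(exp_poly p c \<longlongrightarrow> c) at_top"
proof -
  have "((\<lambda>t. (\<Sum>i\<le>degree p. Polynomial.coeff p i * (t ^ i / exp t)) + c)
      \<longlongrightarrow> (\<Sum>i\<le>degree p. Polynomial.coeff p i * 0) + c) at_top"
    by (intro tendsto_intros tendsto_power_div_exp_0)
  moreover have "exp_poly p c = (\<lambda>t. (\<Sum>i\<le>degree p. Polynomial.coeff p i * (t ^ i / exp t)) + c)"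
    by (rule ext) (simp add: exp_poly_def poly_altdef sum_distrib_left exp_minus field_simps)
  ultimately show ?thesis
    by simp
qed

lemma exp_poly_MVT:
  assumes "u < v"
  obtains \<xi> d where "u < \<xi>" "\<xi> < v" "0 < d"
    "exp_poly p c v - exp_poly p c u = d * poly (slope_poly p) \<xi>"
proof -
  obtain \<xi> where "u < \<xi>" "\<xi> < v"
    "exp_poly p c v - exp_poly p c u = (v - u) * (exp (- \<xi>) * poly (slope_poly p) \<xi>)"
    using MVT2[OF assms, of "exp_poly p c" "\<lambda>t. exp (- t) * poly (slope_poly p) t"]
      exp_poly_has_derivative by blast
  then show thesis
    using that[of \<xi> "(v - u) * exp (- \<xi>)"] assms by simp
qed

lemma slope_sign_between:
  assumes uv: "u < v" and rise: "0 \<le> \<sigma> * (exp_poly p c v - exp_poly p c u)"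
  shows "\<exists>\<xi>. u < \<xi> \<and> \<xi> < v \<and> 0 \<le> \<sigma> * poly (slope_poly p) \<xi>"
proof -
  obtain \<xi> d where \<xi>: "u < \<xi>" "\<xi> < v" "0 < d"
    "exp_poly p c v - exp_poly p c u = d * poly (slope_poly p) \<xi>"
    by (rule exp_poly_MVT[OF uv])
  have "0 \<le> d * (\<sigma> * poly (slope_poly p) \<xi>)"
    using rise by (simp add: \<xi>(4) mult_ac)
  then have "0 \<le> \<sigma> * poly (slope_poly p) \<xi>"
    using \<xi>(3) by (simp add: zero_le_mult_iff)
  then show ?thesis
    using \<xi>(1,2) by blast
qed

text \<open>
  The analogue of \<open>slope_sign_between\<close> with infinity as right end, where the limit \<open>c\<close> is the
  value: if \<open>\<sigma>\<close> times the function sloped downwards everywhere beyond \<open>u\<close>, so that it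
  decreased strictly, its limit would lie below its value at \<open>u\<close>.
\<close>

lemma slope_sign_unbounded:
  assumes rise: "0 \<le> \<sigma> * (c - exp_poly p c u)"
  shows "\<exists>\<xi>>u. 0 \<le> \<sigma> * poly (slope_poly p) \<xi>"
proof (rule ccontr)
  assume "\<not> ?thesis"
  then have neg: "\<sigma> * poly (slope_poly p) \<xi> < 0" if "\<xi> > u" for \<xi>
    using that by (auto simp: not_le)
  have dec: "\<sigma> * exp_poly p c t < \<sigma> * exp_poly p c s" if "u \<le> s" "s < t" for s t
  proof -
    obtain \<xi> d where \<xi>: "s < \<xi>" "\<xi> < t" "0 < d"
      "exp_poly p c t - exp_poly p c s = d * poly (slope_poly p) \<xi>"
      by (rule exp_poly_MVT[OF \<open>s < t\<close>])
    have "\<sigma> * exp_poly p c t - \<sigma> * exp_poly p c s = d * (\<sigma> * poly (slope_poly p) \<xi>)"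
      using \<xi>(4) by (simp flip: right_diff_distrib)
    also have "\<dots> < 0"
      by (rule mult_pos_neg[OF \<xi>(3) neg]) (use \<xi> that in simp)
    finally show ?thesis
      by simp
  qed
  have "((\<lambda>t. \<sigma> * exp_poly p c t) \<longlongrightarrow> \<sigma> * c) at_top"
    by (intro tendsto_intros exp_poly_tendsto)
  moreover have "\<forall>\<^sub>F t in at_top. \<sigma> * exp_poly p c t \<le> \<sigma> * exp_poly p c (u + 1)"
    using eventually_gt_at_top[of "u + 1"] by eventually_elim (rule less_imp_le, rule dec, auto)
  ultimately have "\<sigma> * c \<le> \<sigma> * exp_poly p c (u + 1)"
    by (intro tendsto_upperbound) auto
  also have "\<dots> < \<sigma> * exp_poly p c u"
    by (rule dec) auto
  finally show False
    using rise by (simp add: right_diff_distrib)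
qed

section \<open>Sign patterns at the nodes\<close>

text \<open>
  The factor \<open>(-1) ^ i\<close> is kept separate, since it is the global sign \<open>\<tau>\<close> to which
  \<open>weakly_alternating_gap_imp_0\<close> is applied; the conditional is the phase shift at the
  interval \<open>i\<close>.
\<close>

lemma lebesgue_sign_eq:
  "lebesgue_sign k i = (if k < i then -1 else 1) * ((-1) ^ i * (-1) ^ k)"
  by (auto simp: lebesgue_sign_def power_int_minus_left minus_one_power_iff)

lemma lebesgue_sign_square [simp]: "lebesgue_sign k i * lebesgue_sign k i = 1"
  by (simp add: lebesgue_sign_eq minus_one_power_iff)

lemma abs_lebesgue_sign [simp]: "\<bar>lebesgue_sign k i\<bar> = 1"
  by (simp add: lebesgue_sign_eq minus_one_power_iff)

lemma lebesgue_sign_step: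
  assumes "1 \<le> m" "m \<noteq> i"
  shows "lebesgue_sign (m - 1) i = - lebesgue_sign m i"
  using assms by (cases m) (auto simp: lebesgue_sign_eq)

lemma lebesgue_sign_own:
  assumes "1 \<le> i"
  shows "lebesgue_sign i i = 1" "lebesgue_sign (i - 1) i = 1"
  using assms by (cases i; simp add: lebesgue_sign_eq minus_one_power_iff)+

definition open_node_interval :: "nat \<Rightarrow> (nat \<Rightarrow> real) \<Rightarrow> nat \<Rightarrow> real set" where
  "open_node_interval n x m = {t. x (m - 1) < t \<and> (m \<le> n \<longrightarrow> t < x m)}"

text \<open>
  Index \<open>n + 1\<close> is the node at infinity, where an exponential polynomial takes its limit \<open>c\<close>.
\<close>

definition node_value :: "nat \<Rightarrow> (nat \<Rightarrow> real) \<Rightarrow> real poly \<Rightarrow> real \<Rightarrow> nat \<Rightarrow> real" where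
  "node_value n x p c m = (if m \<le> n then exp_poly p c (x m) else c)"

text \<open>
  One point \<open>\<xi> m\<close> from every interval \<open>m\<close>, except that interval \<open>j\<close> contributes the three points
  \<open>a < z < b\<close>. Interval \<open>m\<close> appears at position \<open>m - 1\<close> if \<open>m < j\<close> and at position \<open>m + 1\<close> if
  \<open>m > j\<close>, so in both cases the parity of the position determines that of \<open>m\<close>.
\<close>

definition refined_points ::
  "(nat \<Rightarrow> real) \<Rightarrow> nat \<Rightarrow> real \<Rightarrow> real \<Rightarrow> real \<Rightarrow> nat \<Rightarrow> real" where
  "refined_points \<xi> j a z b i =
     (if i + 1 < j then \<xi> (i + 1) else if i + 1 = j then a else if i = j then z
      else if i = j + 1 then b else \<xi> (i - 1))"

locale exp_nodes =
  fixes n :: nat and x :: "nat \<Rightarrow> real"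
  assumes n_pos: "1 \<le> n" and x_simplex: "x \<in> node_simplex n"
begin

lemma node_strict_mono: "strict_mono_on {..n} x"
proof (rule strict_mono_onI)
  fix i k assume "i \<in> {..n}" "k \<in> {..n}" "i < k"
  from \<open>i < k\<close> \<open>k \<in> {..n}\<close> show "x i < x k"
  proof (induction k rule: less_induct)
    case (less k)
    then obtain k' where k': "k = Suc k'"
      by (cases k) auto
    have step: "x k' < x k"
      using x_simplex less.prems k' by (simp add: node_simplex_def)
    show ?case
    proof (cases "i = k'")
      case False
      then have "x i < x k'"
        using less.prems k' by (intro less.IH) auto
      then show ?thesis
        using step by simp
    qed (use step in simp)
  qed
qed

lemma node_less: "i < k \<Longrightarrow> k \<le> n \<Longrightarrow> x i < x k"
  by (rule strict_mono_onD[OF node_strict_mono]) auto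

lemma node_le: "i \<le> k \<Longrightarrow> k \<le> n \<Longrightarrow> x i \<le> x k"
  using node_less[of i k] by (cases "i = k") auto

lemma node_inj: "inj_on x {..n}"
  by (rule strict_mono_on_imp_inj_on[OF node_strict_mono])

lemma open_node_interval_less:
  assumes "s \<in> open_node_interval n x m" "t \<in> open_node_interval n x m'"
    and "1 \<le> m" "m < m'" "m' \<le> n + 1"
  shows "s < t"
proof -
  have "x m \<le> x (m' - 1)"
    using assms by (intro node_le) auto
  then show ?thesis
    using assms by (auto simp: open_node_interval_def)
qed

lemma refined_points_strict_mono:
  assumes j: "1 \<le> j" "j \<le> n + 1"
    and \<xi>: "\<And>m. 1 \<le> m \<Longrightarrow> m \<le> n + 1 \<Longrightarrow> \<xi> m \<in> open_node_interval n x m"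
    and abz: "a \<in> open_node_interval n x j" "b \<in> open_node_interval n x j" "a < z" "z < b"
  shows "strict_mono_on {..n + 2} (refined_points \<xi> j a z b)"
proof -
  \<comment> \<open>The interval that contains the point at position \<open>i\<close>.\<close>
  define M where "M i = (if i + 1 < j then i + 1 else if i \<le> j + 1 then j else i - 1)" for i
  have z: "z \<in> open_node_interval n x j"
    using abz by (auto simp: open_node_interval_def)
  have mem: "refined_points \<xi> j a z b i \<in> open_node_interval n x (M i)"
    and M: "1 \<le> M i" "M i \<le> n + 1" if "i \<le> n + 2" for i
    using that j abz z by (auto simp: refined_points_def M_def intro!: \<xi>)
  show ?thesis
  proof (rule strict_mono_onI)
    fix i k assume ik: "i \<in> {..n + 2}" "k \<in> {..n + 2}" "i < k"
    show "refined_points \<xi> j a z b i < refined_points \<xi> j a z b k"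
    proof (cases "M i < M k")
      case True
      then show ?thesis
        using ik M[of i] M[of k] mem[of i] mem[of k] by (intro open_node_interval_less) auto
    next
      case False
      then have "j \<le> i + 1" "k \<le> j + 1"
        using ik j by (auto simp: M_def split: if_splits)
      then show ?thesis
        using ik abz by (auto simp: refined_points_def)
    qed
  qed
qed

lemma node_value_pred:
  assumes "1 \<le> m" "m \<le> n + 1"
  shows "node_value n x p c (m - 1) = exp_poly p c (x (m - 1))"
proof -
  have "m - 1 \<le> n"
    using assms by linarith
  then show ?thesis
    by (simp add: node_value_def)
qed

lemma slope_sign_right:
  assumes u: "x (m - 1) \<le> u" "m \<le> n \<longrightarrow> u < x m" and m: "1 \<le> m" "m \<le> n + 1"
    and rise: "0 \<le> \<sigma> * (node_value n x p c m - exp_poly p c u)"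
  shows "\<exists>\<xi>\<in>open_node_interval n x m. u < \<xi> \<and> 0 \<le> \<sigma> * poly (slope_poly p) \<xi>"
proof (cases "m \<le> n")
  case True
  then show ?thesis
    using slope_sign_between[of u "x m" \<sigma> p c] u rise
    by (force simp: node_value_def open_node_interval_def)
next
  case False
  then show ?thesis
    using slope_sign_unbounded[of \<sigma> c p u] u rise
    by (force simp: node_value_def open_node_interval_def)
qed

lemma slope_sign_left:
  assumes t: "t \<in> open_node_interval n x m" and m: "1 \<le> m" "m \<le> n + 1"
    and rise: "0 \<le> \<sigma> * (exp_poly p c t - node_value n x p c (m - 1))"
  shows "\<exists>\<xi>\<in>open_node_interval n x m. \<xi> < t \<and> 0 \<le> \<sigma> * poly (slope_poly p) \<xi>"
proof -
  have "x (m - 1) < t" "0 \<le> \<sigma> * (exp_poly p c t - exp_poly p c (x (m - 1)))"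
    using t rise[unfolded node_value_pred[OF m]] by (auto simp: open_node_interval_def)
  from slope_sign_between[OF this] obtain \<xi> where
    "x (m - 1) < \<xi>" "\<xi> < t" "0 \<le> \<sigma> * poly (slope_poly p) \<xi>"
    by blast
  then show ?thesis
    using t by (intro bexI[of _ \<xi>]) (auto simp: open_node_interval_def)
qed

text \<open>
  The signs of the pattern flip from node \<open>m - 1\<close> to node \<open>m\<close> for every \<open>m \<noteq> l\<close>, so the function
  moves in the direction of the sign at node \<open>m\<close>. For \<open>m = l\<close> the signs at both ends agree and
  the slope is unknown.
\<close>

lemma alternating_slope_points:
  assumes alt: "\<And>m. m \<le> n + 1 \<Longrightarrow> 0 \<le> lebesgue_sign m l * node_value n x p c m"
  obtains \<xi> where "\<And>m. 1 \<le> m \<Longrightarrow> m \<le> n + 1 \<Longrightarrow> \<xi> m \<in> open_node_interval n x m"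
    and "\<And>m. 1 \<le> m \<Longrightarrow> m \<le> n + 1 \<Longrightarrow> m \<noteq> l \<Longrightarrow>
            0 \<le> lebesgue_sign m l * poly (slope_poly p) (\<xi> m)"
proof -
  have "\<exists>\<xi>\<in>open_node_interval n x m. m \<noteq> l \<longrightarrow> 0 \<le> lebesgue_sign m l * poly (slope_poly p) \<xi>"
    if m: "1 \<le> m" "m \<le> n + 1" for m
  proof -
    define \<sigma> where "\<sigma> = (if m = l then 0 else lebesgue_sign m l)"
    have "0 \<le> lebesgue_sign (m - 1) l * node_value n x p c (m - 1)"
      using m by (intro alt) simp
    then have "0 \<le> \<sigma> * (node_value n x p c m - node_value n x p c (m - 1))"
      using alt[OF m(2)] lebesgue_sign_step[OF m(1), of l]
      by (auto simp: \<sigma>_def right_diff_distrib simp del: One_nat_def)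
    then have "0 \<le> \<sigma> * (node_value n x p c m - exp_poly p c (x (m - 1)))"
      unfolding node_value_pred[OF m] .
    from slope_sign_right[OF _ _ m this] show ?thesis
      using m node_less[of "m - 1" m] by (auto simp: \<sigma>_def)
  qed
  then have "\<forall>m. \<exists>\<xi>. 1 \<le> m \<and> m \<le> n + 1 \<longrightarrow> \<xi> \<in> open_node_interval n x m \<and>
      (m \<noteq> l \<longrightarrow> 0 \<le> lebesgue_sign m l * poly (slope_poly p) \<xi>)"
    by blast
  from choice[OF this] show thesis
    using that by blast
qed

text \<open>
  Around its own interval the pattern \<open>j\<close> rises before and falls after. A function with this
  pattern that also falls at \<open>a\<close> and rises at a later \<open>b\<close> inside the interval has a derivative
  with \<open>n + 2\<close> weak alternations. The middle point of the refined sequence carries no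
  information and serves as the gap.
\<close>

lemma descent_in_own_interval_imp_0:
  assumes deg: "degree p \<le> n" and j: "1 \<le> j" "j \<le> n + 1"
    and alt: "\<And>m. m \<le> n + 1 \<Longrightarrow> 0 \<le> lebesgue_sign m j * node_value n x p c m"
    and ab: "a \<in> open_node_interval n x j" "b \<in> open_node_interval n x j" "a < b"
    and slope: "poly (slope_poly p) a \<le> 0" "0 \<le> poly (slope_poly p) b"
  shows "p = 0"
proof -
  obtain \<xi> where \<xi>: "\<And>m. 1 \<le> m \<Longrightarrow> m \<le> n + 1 \<Longrightarrow> \<xi> m \<in> open_node_interval n x m"
    and sg: "\<And>m. 1 \<le> m \<Longrightarrow> m \<le> n + 1 \<Longrightarrow> m \<noteq> j \<Longrightarrow>
            0 \<le> lebesgue_sign m j * poly (slope_poly p) (\<xi> m)"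
    using alternating_slope_points[OF alt] by blast
  define v where "v = refined_points \<xi> j a ((a + b) / 2) b"
  have "slope_poly p = 0"
  proof (rule weakly_alternating_gap_imp_0)
    show "degree (slope_poly p) \<le> n"
      by (rule degree_slope_poly[OF deg])
    show "strict_mono_on {..n + 2} v"
      unfolding v_def by (rule refined_points_strict_mono) (use j \<xi> ab in auto)
    show "j \<le> n + 2" "(-1 :: real) ^ j \<noteq> 0"
      using j by auto
  next
    fix i assume i: "i < j"
    show "0 \<le> (-1) ^ j * (-1) ^ i * poly (slope_poly p) (v i)"
    proof (cases "i + 1 = j")
      case True
      then show ?thesis
        using slope(1) by (auto simp: v_def refined_points_def simp flip: power_add)
    next
      case False
      then show ?thesis
        using sg[of "i + 1"] i j
        by (simp add: v_def refined_points_def lebesgue_sign_eq power_add mult_ac)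
    qed
  next
    fix i assume i: "j < i" "i \<le> n + 2"
    show "(-1) ^ j * (-1) ^ i * poly (slope_poly p) (v i) \<le> 0"
    proof (cases "i = j + 1")
      case True
      then show ?thesis
        using slope(2) by (auto simp: v_def refined_points_def simp flip: power_add)
    next
      case False
      then obtain m where "i = Suc m" "j < m"
        using i by (cases i) auto
      then show ?thesis
        using sg[of m] i j
        by (simp add: v_def refined_points_def lebesgue_sign_eq power_add mult_ac)
    qed
  qed
  then show ?thesis
    by simp
qed

text \<open>
  On an interval \<open>j \<noteq> l\<close> the pattern \<open>l\<close> moves in one direction. If the slope goes the right way
  at \<open>a\<close>, the wrong way at \<open>z\<close> and the right way again at \<open>b\<close>, two alternations are added to
  those from the remaining intervals. The gap is the point in interval \<open>l\<close>.
\<close>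

lemma descent_in_other_interval_imp_0:
  assumes deg: "degree p \<le> n" and j: "1 \<le> j" "j \<le> n + 1" and l: "1 \<le> l" "l \<le> n + 1" "l \<noteq> j"
    and alt: "\<And>m. m \<le> n + 1 \<Longrightarrow> 0 \<le> lebesgue_sign m l * node_value n x p c m"
    and ab: "a \<in> open_node_interval n x j" "b \<in> open_node_interval n x j" "a < z" "z < b"
    and slope: "0 \<le> lebesgue_sign j l * poly (slope_poly p) a"
      "lebesgue_sign j l * poly (slope_poly p) z \<le> 0"
      "0 \<le> lebesgue_sign j l * poly (slope_poly p) b"
  shows "p = 0"
proof -
  obtain \<xi> where \<xi>: "\<And>m. 1 \<le> m \<Longrightarrow> m \<le> n + 1 \<Longrightarrow> \<xi> m \<in> open_node_interval n x m"
    and sg: "\<And>m. 1 \<le> m \<Longrightarrow> m \<le> n + 1 \<Longrightarrow> m \<noteq> l \<Longrightarrow>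
            0 \<le> lebesgue_sign m l * poly (slope_poly p) (\<xi> m)"
    using alternating_slope_points[OF alt] by blast
  define v where "v = refined_points \<xi> j a z b"
  \<comment> \<open>The position of interval \<open>l\<close> in the refined sequence.\<close>
  define g where "g = (if l < j then l - 1 else l + 1)"
  have sign: "0 \<le> (if i < g then 1 else -1) * ((-1) ^ l * (-1) ^ i) * poly (slope_poly p) (v i)"
    if i: "i \<le> n + 2" "i \<noteq> g" for i
  proof -
    consider "i + 1 < j" | "i + 1 = j" | "i = j" | "i = j + 1" | "j + 1 < i"
      by linarith
    then show ?thesis
    proof cases
      case 1
      then have "i < g \<longleftrightarrow> i + 1 < l" "v i = \<xi> (i + 1)"
        using i j l by (auto simp: g_def v_def refined_points_def)
      then show ?thesis
        using sg[of "i + 1"] 1 i j l by (auto simp: g_def lebesgue_sign_eq split: if_splits)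
    next
      case 2
      then have "i < g \<longleftrightarrow> j < l" "v i = a"
        using i j l by (auto simp: g_def v_def refined_points_def)
      then show ?thesis
        using slope(1) 2 i j l by (auto simp: g_def lebesgue_sign_eq split: if_splits)
    next
      case 3
      then have "i < g \<longleftrightarrow> j < l" "v i = z"
        using i j l by (auto simp: g_def v_def refined_points_def)
      then show ?thesis
        using slope(2) 3 i j l by (auto simp: g_def lebesgue_sign_eq split: if_splits)
    next
      case 4
      then have "i < g \<longleftrightarrow> j < l" "v i = b"
        using i j l by (auto simp: g_def v_def refined_points_def)
      then show ?thesis
        using slope(3) 4 i j l by (auto simp: g_def lebesgue_sign_eq split: if_splits)
    next
      case 5
      then obtain m where m: "i = Suc m" "j < m"
        by (cases i) auto
      then have "i < g \<longleftrightarrow> m < l" "v i = \<xi> m"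
        using i j l by (auto simp: g_def v_def refined_points_def)
      then show ?thesis
        using sg[of m] m i j l by (auto simp: g_def lebesgue_sign_eq split: if_splits)
    qed
  qed
  have "slope_poly p = 0"
  proof (rule weakly_alternating_gap_imp_0[where g = g and \<tau> = "(-1) ^ l"])
    show "degree (slope_poly p) \<le> n"
      by (rule degree_slope_poly[OF deg])
    show "strict_mono_on {..n + 2} v"
      unfolding v_def by (rule refined_points_strict_mono) (use j \<xi> ab in auto)
    show g: "g \<le> n + 2"
      using l by (auto simp: g_def)
    show "0 \<le> (-1) ^ l * (-1) ^ i * poly (slope_poly p) (v i)" if "i < g" for i
      using sign[of i] that g by simp
    show "(-1) ^ l * (-1) ^ i * poly (slope_poly p) (v i) \<le> 0" if "g < i" "i \<le> n + 2" for i
      using sign[of i] that by simp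
  qed simp
  then show ?thesis
    by simp
qed

text \<open>
  A negative value at \<open>t\<close> between nonnegative values at both ends of interval \<open>j\<close> produces a
  descent followed by an ascent. Comparisons between the pieces, and between a piece and a
  constant, are instances, because all of them are decided by signs at the nodes.
\<close>

lemma nonneg_of_lebesgue_signs:
  assumes deg: "degree p \<le> n" and j: "1 \<le> j" "j \<le> n + 1"
    and alt: "\<And>m. m \<le> n + 1 \<Longrightarrow> 0 \<le> lebesgue_sign m j * node_value n x p c m"
    and t: "t \<in> open_node_interval n x j"
  shows "0 \<le> exp_poly p c t"
proof (rule ccontr)
  assume "\<not> ?thesis"
  then have neg: "exp_poly p c t < 0"
    by simp
  have "0 \<le> lebesgue_sign (j - 1) j * node_value n x p c (j - 1)"
    using j by (intro alt) simp
  then have ends: "0 \<le> node_value n x p c (j - 1)" "0 \<le> node_value n x p c j"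
    using alt[OF j(2)] j by (auto simp: lebesgue_sign_own simp del: One_nat_def)
  obtain a where a: "a \<in> open_node_interval n x j" "a < t" "0 \<le> (-1) * poly (slope_poly p) a"
    using slope_sign_left[OF t j, of "-1" p c] neg ends by auto
  obtain b where b: "b \<in> open_node_interval n x j" "t < b" "0 \<le> 1 * poly (slope_poly p) b"
    using slope_sign_right[of j t 1 p c] t j neg ends by (auto simp: open_node_interval_def)
  have "p = 0"
    by (rule descent_in_own_interval_imp_0[OF deg j alt a(1) b(1)]) (use a b in auto)
  then show False
    using neg ends by (simp add: node_value_def exp_poly_def split: if_splits)
qed

end

section \<open>The pieces of the Lebesgue function\<close>

text \<open>
  Since all fundamental functions add up to 1, \<open>P\<^sub>i\<close> is the constant \<open>\<epsilon>\<^sub>n\<^sub>+\<^sub>1\<^sub>,\<^sub>i\<close> plus the sum of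
  \<open>(\<epsilon>\<^sub>k\<^sub>,\<^sub>i - \<epsilon>\<^sub>n\<^sub>+\<^sub>1\<^sub>,\<^sub>i) h\<^sub>k\<close> over \<open>k \<le> n\<close>; this is the polynomial factor of that sum.
\<close>

definition piece_poly :: "nat \<Rightarrow> (nat \<Rightarrow> real) \<Rightarrow> nat \<Rightarrow> real poly" where
  "piece_poly n x i =
     (\<Sum>k\<le>n. smult ((lebesgue_sign k i - lebesgue_sign (n + 1) i)
                * (exp (x k) / (\<Prod>l\<in>{0..n} - {k}. x k - x l)))
              (\<Prod>l\<in>{0..n} - {k}. [:- x l, 1:]))"

lemma degree_piece_poly: "degree (piece_poly n x i) \<le> n"
  unfolding piece_poly_def
proof (rule degree_sum_le)
  fix k assume "k \<in> {..n}"
  then have "degree (\<Prod>l\<in>{0..n} - {k}. [:- x l, 1:]) = n"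
    by (subst degree_prod_sum_eq) auto
  then show "degree (smult ((lebesgue_sign k i - lebesgue_sign (n + 1) i)
                * (exp (x k) / (\<Prod>l\<in>{0..n} - {k}. x k - x l)))
              (\<Prod>l\<in>{0..n} - {k}. [:- x l, 1:])) \<le> n"
    using degree_smult_le order_trans by (metis le_refl)
qed simp

lemma exp_lagrange_eq:
  "exp_lagrange n x k t = exp (- t) * (exp (x k) / (\<Prod>l\<in>{0..n} - {k}. x k - x l)
     * poly (\<Prod>l\<in>{0..n} - {k}. [:- x l, 1:]) t)"
  by (simp add: exp_lagrange_def prod_dividef poly_prod exp_minus field_simps)

lemma lebesgue_piece_eq:
  "lebesgue_piece n x i t =
     (\<Sum>k\<le>n. (lebesgue_sign k i - lebesgue_sign (n + 1) i) * exp_lagrange n x k t)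
       + lebesgue_sign (n + 1) i"
proof -
  have "lebesgue_piece n x i t = (\<Sum>k\<le>n. lebesgue_sign k i * exp_lagrange n x k t)
      + lebesgue_sign (n + 1) i * (1 - (\<Sum>k\<le>n. exp_lagrange n x k t))"
    by (simp add: lebesgue_piece_def fundamental_def atMost_atLeast0)
  then show ?thesis
    by (simp add: sum_subtractf left_diff_distrib right_diff_distrib sum_distrib_left)
qed

lemma lebesgue_piece_exp_poly:
  "lebesgue_piece n x i = exp_poly (piece_poly n x i) (lebesgue_sign (n + 1) i)"
  by (rule ext) (simp add: lebesgue_piece_eq exp_poly_def piece_poly_def exp_lagrange_eq
      poly_sum sum_distrib_left mult_ac)

context exp_nodes
begin

abbreviation piece_value :: "nat \<Rightarrow> nat \<Rightarrow> real" where
  "piece_value i \<equiv> node_value n x (piece_poly n x i) (lebesgue_sign (n + 1) i)"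

lemma exp_lagrange_node:
  assumes "k \<le> n" "m \<le> n"
  shows "exp_lagrange n x k (x m) = (if k = m then 1 else 0)"
proof (cases "k = m")
  case True
  have "(x k - x l) / (x k - x l) = 1" if "l \<in> {0..n} - {k}" for l
    using inj_onD[OF node_inj, of k l] that assms by auto
  then show ?thesis
    using True by (simp add: exp_lagrange_def del: divide_self_if)
next
  case False
  then show ?thesis
    using assms by (auto simp: exp_lagrange_def)
qed

lemma piece_value:
  assumes "m \<le> n + 1"
  shows "piece_value i m = lebesgue_sign m i"
proof (cases "m \<le> n")
  case True
  have "lebesgue_piece n x i (x m)
      = (\<Sum>k\<le>n. if k = m then lebesgue_sign k i - lebesgue_sign (n + 1) i else 0)
        + lebesgue_sign (n + 1) i"
    unfolding lebesgue_piece_eq using True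
    by (intro arg_cong2[of _ _ _ _ "(+)"] sum.cong refl) (auto simp: exp_lagrange_node)
  then show ?thesis
    using True by (simp add: node_value_def lebesgue_piece_exp_poly)
next
  case False
  then have "m = n + 1"
    using assms by simp
  then show ?thesis
    by (simp add: node_value_def)
qed

lemma node_value_lincomb:
  "node_value n x (smult a p + smult b q) (a * c + b * d) m
     = a * node_value n x p c m + b * node_value n x q d m"
  by (simp add: node_value_def exp_poly_def algebra_simps)

lemma degree_lincomb:
  "degree p \<le> n \<Longrightarrow> degree q \<le> n \<Longrightarrow> degree (smult a p + smult b q :: real poly) \<le> n"
  by (rule degree_add_le) (auto intro: order_trans[OF degree_smult_le])

text \<open>
  \<open>P\<^sub>j - 1\<close> takes the value \<open>\<epsilon> - 1\<close> at a node with sign \<open>\<epsilon>\<close>, and \<open>\<epsilon> (\<epsilon> - 1) = 1 - \<epsilon> \<ge> 0\<close>.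
\<close>

lemma lebesgue_piece_ge_1:
  assumes j: "1 \<le> j" "j \<le> n + 1" and t: "t \<in> open_node_interval n x j"
  shows "1 \<le> lebesgue_piece n x j t"
proof -
  define P where "P = piece_poly n x j"
  have "0 \<le> exp_poly P (lebesgue_sign (n + 1) j - 1) t"
  proof (rule nonneg_of_lebesgue_signs[OF _ j _ t])
    show "degree P \<le> n"
      unfolding P_def by (rule degree_piece_poly)
    fix m assume m: "m \<le> n + 1"
    have "node_value n x P (lebesgue_sign (n + 1) j - 1) m = lebesgue_sign m j - 1"
      using piece_value[OF m, of j] by (simp add: P_def node_value_def exp_poly_def split: if_splits)
    then show "0 \<le> lebesgue_sign m j * node_value n x P (lebesgue_sign (n + 1) j - 1) m"
      using abs_lebesgue_sign[of m j] abs_ge_self[of "lebesgue_sign m j"]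
      by (simp add: right_diff_distrib)
  qed
  then show ?thesis
    by (simp add: lebesgue_piece_exp_poly P_def exp_poly_def)
qed

text \<open>
  At every node the signs of \<open>P\<^sub>j \<plusminus> P\<^sub>l\<close> are weakly those of \<open>P\<^sub>j\<close>, because \<open>P\<^sub>l\<close> has modulus 1
  there.
\<close>

lemma abs_lebesgue_piece_le:
  assumes j: "1 \<le> j" "j \<le> n + 1" and t: "t \<in> open_node_interval n x j"
  shows "\<bar>lebesgue_piece n x l t\<bar> \<le> lebesgue_piece n x j t"
proof -
  have "0 \<le> lebesgue_piece n x j t + a * lebesgue_piece n x l t" if a: "\<bar>a\<bar> = 1" for a
  proof -
    \<comment> \<open>The factors 1 give \<open>P\<close> and \<open>c\<close> the shape of \<open>node_value_lincomb\<close>.\<close>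
    define P where "P = smult 1 (piece_poly n x j) + smult a (piece_poly n x l)"
    define c where "c = 1 * lebesgue_sign (n + 1) j + a * lebesgue_sign (n + 1) l"
    have "0 \<le> exp_poly P c t"
    proof (rule nonneg_of_lebesgue_signs[OF _ j _ t])
      show "degree P \<le> n"
        unfolding P_def by (intro degree_lincomb degree_piece_poly)
      fix m assume m: "m \<le> n + 1"
      have "node_value n x P c m = lebesgue_sign m j + a * lebesgue_sign m l"
        unfolding P_def c_def node_value_lincomb using piece_value[OF m, of j] piece_value[OF m, of l] by simp
      moreover have "\<bar>lebesgue_sign m j * (a * lebesgue_sign m l)\<bar> = 1"
        using a by (simp add: abs_mult)
      ultimately show "0 \<le> lebesgue_sign m j * node_value n x P c m"
        by (simp add: distrib_left)
    qed
    then show ?thesis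
      by (simp add: lebesgue_piece_exp_poly P_def c_def exp_poly_def algebra_simps)
  qed
  from this[of 1] this[of "-1"] show ?thesis
    by simp
qed

lemma piece_poly_nonzero:
  assumes j: "1 \<le> j" "j \<le> n + 1"
  shows "piece_poly n x j \<noteq> 0"
proof
  assume 0: "piece_poly n x j = 0"
  then have const: "lebesgue_sign m j = lebesgue_sign (n + 1) j" if "m \<le> n + 1" for m
    using piece_value[OF that, of j] by (simp add: node_value_def exp_poly_def split: if_splits)
  have own: "lebesgue_sign (n + 1) j = 1"
    using const[OF j(2)] j by (simp add: lebesgue_sign_own)
  show False
  proof (cases "j \<le> n")
    case True
    then show False
      using const[of "j + 1"] own by (simp add: lebesgue_sign_eq)
  next
    case False
    then have "j = n + 1"
      using j by simp
    then show False
      using const[OF trans_le_add1[OF diff_le_self[of n 1], of 1]] own n_pos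
      by (simp add: lebesgue_sign_eq minus_one_power_iff split: if_splits)
  qed
qed

section \<open>The maximum points\<close>

abbreviation piece_slope :: "nat \<Rightarrow> real poly" where
  "piece_slope i \<equiv> slope_poly (piece_poly n x i)"

lemma lebesgue_piece_has_derivative:
  "(lebesgue_piece n x i has_real_derivative exp (- t) * poly (piece_slope i) t) (at t)"
  unfolding lebesgue_piece_exp_poly by (rule exp_poly_has_derivative)

lemma continuous_on_lebesgue_piece: "continuous_on A (lebesgue_piece n x i)"
  unfolding lebesgue_piece_exp_poly by (rule continuous_on_exp_poly)

lemma open_node_interval_subset:
  assumes "1 \<le> j" "j \<le> n + 1"
  shows "open_node_interval n x j \<subseteq> node_interval n x j"
  using assms by (auto simp: open_node_interval_def node_interval_def le_antisym not_le dest: Suc_leI)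

lemma node_interval_cases:
  assumes "1 \<le> j" "j \<le> n + 1" "t \<in> node_interval n x j"
  shows "t \<in> open_node_interval n x j \<or> t = x (j - 1) \<or> (j \<le> n \<and> t = x j)"
proof (cases "j \<le> n")
  case False
  then have "j - 1 = n"
    using assms by simp
  then show ?thesis
    using assms False by (auto simp: open_node_interval_def node_interval_def)
qed (use assms in \<open>auto simp: open_node_interval_def node_interval_def\<close>)

lemma lebesgue_piece_end:
  assumes j: "1 \<le> j" "j \<le> n + 1"
  shows "lebesgue_piece n x j (x (j - 1)) = 1" "j \<le> n \<Longrightarrow> lebesgue_piece n x j (x j) = 1"
proof -
  have "piece_value j (j - 1) = 1"
    using j by (subst piece_value) (auto simp: lebesgue_sign_own simp del: One_nat_def)
  then show "lebesgue_piece n x j (x (j - 1)) = 1"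
    using j by (simp add: node_value_def lebesgue_piece_exp_poly split: if_splits)
  show "lebesgue_piece n x j (x j) = 1" if "j \<le> n"
    using piece_value[OF j(2), of j] j that
    by (simp add: node_value_def lebesgue_piece_exp_poly lebesgue_sign_own)
qed

lemma two_points_in_open_node_interval:
  assumes "1 \<le> j" "j \<le> n + 1"
  obtains s t where "s \<in> open_node_interval n x j" "t \<in> open_node_interval n x j" "s < t"
proof -
  define w where "w = (if j \<le> n then x j else x (j - 1) + 1)"
  have w: "x (j - 1) < w"
    using assms node_less[of "j - 1" j] by (auto simp: w_def)
  define s t where "s = (2 * x (j - 1) + w) / 3" and "t = (x (j - 1) + 2 * w) / 3"
  show thesis
    by (rule that[of s t]) (use w in \<open>auto simp: s_def t_def open_node_interval_def w_def field_simps\<close>)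
qed

lemma open_open_node_interval: "open (open_node_interval n x j)"
proof -
  have "open_node_interval n x j = (if j \<le> n then {x (j - 1)<..<x j} else {x (j - 1)<..})"
    by (auto simp: open_node_interval_def)
  then show ?thesis
    by simp
qed

text \<open>
  Two zeros of the slope count as a descent followed by an ascent in the weak sense.
\<close>

lemma critical_point_unique:
  assumes j: "1 \<le> j" "j \<le> n + 1"
    and s: "s \<in> open_node_interval n x j" "poly (slope_poly (piece_poly n x j)) s = 0"
    and t: "t \<in> open_node_interval n x j" "poly (slope_poly (piece_poly n x j)) t = 0"
  shows "s = t"
proof -
  have False
    if "a \<in> open_node_interval n x j" "poly (slope_poly (piece_poly n x j)) a = 0"
      "b \<in> open_node_interval n x j" "poly (slope_poly (piece_poly n x j)) b = 0" "a < b" for a b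
  proof -
    have "piece_poly n x j = 0"
    proof (rule descent_in_own_interval_imp_0[OF degree_piece_poly j _ that(1,3,5)])
      fix m assume m: "m \<le> n + 1"
      show "0 \<le> lebesgue_sign m j * piece_value j m"
        unfolding piece_value[OF m] by simp
    next
      show "poly (slope_poly (piece_poly n x j)) a \<le> 0"
        "0 \<le> poly (slope_poly (piece_poly n x j)) b"
        unfolding that by simp_all
    qed
    then show False
      using piece_poly_nonzero[OF j] by simp
  qed
  then show ?thesis
    using s t by (meson linorder_neqE)
qed

text \<open>
  Otherwise the piece would be constant on the interval and every interior point critical. This
  keeps the maximum away from the ends, where the piece equals 1, and from infinity.
\<close>

lemma lebesgue_piece_exceeds_1:
  assumes j: "1 \<le> j" "j \<le> n + 1"
  obtains t where "t \<in> open_node_interval n x j" "1 < lebesgue_piece n x j t"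
proof (rule ccontr)
  assume "\<not> thesis"
  then have le: "lebesgue_piece n x j t \<le> 1" if "t \<in> open_node_interval n x j" for t
    using that \<open>\<And>t. t \<in> open_node_interval n x j \<Longrightarrow> 1 < lebesgue_piece n x j t \<Longrightarrow> thesis\<close>
    by (meson not_le)
  then have const: "lebesgue_piece n x j t = 1" if "t \<in> open_node_interval n x j" for t
    using lebesgue_piece_ge_1[OF j that] that by (meson order_antisym)
  have crit: "poly (piece_slope j) t = 0" if t: "t \<in> open_node_interval n x j" for t
  proof -
    have "(lebesgue_piece n x j has_real_derivative 0) (at t)"
      by (rule has_field_derivative_transform_within_open
          [OF DERIV_const open_open_node_interval t]) (simp add: const)
    then show ?thesis
      using DERIV_unique[OF lebesgue_piece_has_derivative] by fastforce
  qed
  obtain s t where st: "s \<in> open_node_interval n x j" "t \<in> open_node_interval n x j" "s < t"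
    by (rule two_points_in_open_node_interval[OF j])
  have "s = t"
    by (rule critical_point_unique[OF j st(1) crit[OF st(1)] st(2) crit[OF st(2)]])
  then show False
    using st(3) by simp
qed

lemma lebesgue_piece_attains_max:
  assumes j: "1 \<le> j" "j \<le> n + 1"
  obtains z where "z \<in> node_interval n x j"
    "\<And>t. t \<in> node_interval n x j \<Longrightarrow> lebesgue_piece n x j t \<le> lebesgue_piece n x j z"
proof (cases "j \<le> n")
  case True
  then have "node_interval n x j = {x (j - 1)..x j}" "x (j - 1) \<le> x j"
    using j node_le[of "j - 1" j] by (auto simp: node_interval_def)
  then show thesis
    using continuous_attains_sup[of "{x (j - 1)..x j}" "lebesgue_piece n x j"]
      continuous_on_lebesgue_piece that by auto
next
  case False
  then have jn: "j = n + 1"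
    using j by simp
  then have I: "node_interval n x j = {x n..}"
    by (simp add: node_interval_def)
  obtain t0 where t0: "t0 \<in> open_node_interval n x j" "1 < lebesgue_piece n x j t0"
    by (rule lebesgue_piece_exceeds_1[OF j])
  \<comment> \<open>Beyond some \<open>T\<close> the piece stays below a value that it attains, so only \<open>[x\<^sub>n, T]\<close> matters.\<close>
  have "(lebesgue_piece n x j \<longlongrightarrow> 1) at_top"
    using exp_poly_tendsto[of "piece_poly n x j" "lebesgue_sign (n + 1) j"] jn
    by (simp add: lebesgue_piece_exp_poly lebesgue_sign_own)
  then have "\<forall>\<^sub>F t in at_top. lebesgue_piece n x j t < lebesgue_piece n x j t0"
    using t0(2) by (rule order_tendstoD(2))
  then obtain T where T: "\<And>t. T \<le> t \<Longrightarrow> lebesgue_piece n x j t < lebesgue_piece n x j t0"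
    by (auto simp: eventually_at_top_linorder)
  have t0n: "x n < t0"
    using t0(1) jn by (simp add: open_node_interval_def)
  have t0T: "t0 < T"
    using T[of t0] by force
  obtain z where z: "z \<in> {x n..T}"
    "\<And>t. t \<in> {x n..T} \<Longrightarrow> lebesgue_piece n x j t \<le> lebesgue_piece n x j z"
    using continuous_attains_sup[of "{x n..T}" "lebesgue_piece n x j"]
      continuous_on_lebesgue_piece t0n t0T by auto
  show thesis
  proof (rule that)
    show "z \<in> node_interval n x j"
      using z(1) I by simp
    fix t assume "t \<in> node_interval n x j"
    then show "lebesgue_piece n x j t \<le> lebesgue_piece n x j z"
      using z(2)[of t] z(2)[of t0] T[of t] t0n t0T I by (cases "t \<le> T") auto
  qed
qed

text \<open>
  Both properties are shown for every maximizer, as they are what makes the maximizer unique.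
\<close>

lemma max_point_interior:
  assumes j: "1 \<le> j" "j \<le> n + 1"
    and z: "is_arg_max (lebesgue_piece n x j) (\<lambda>t. t \<in> node_interval n x j) z"
  shows "z \<in> open_node_interval n x j" "poly (piece_slope j) z = 0"
proof -
  have zI: "z \<in> node_interval n x j"
    and max: "\<And>t. t \<in> node_interval n x j \<Longrightarrow> lebesgue_piece n x j t \<le> lebesgue_piece n x j z"
    using z by (auto simp: is_arg_max_linorder)
  obtain t0 where t0: "t0 \<in> open_node_interval n x j" "1 < lebesgue_piece n x j t0"
    by (rule lebesgue_piece_exceeds_1[OF j])
  have "1 < lebesgue_piece n x j z"
    using t0 max[of t0] open_node_interval_subset[OF j] by fastforce
  then show zo: "z \<in> open_node_interval n x j"
    using node_interval_cases[OF j zI] lebesgue_piece_end[OF j] by auto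
  obtain \<epsilon> where \<epsilon>: "0 < \<epsilon>" "ball z \<epsilon> \<subseteq> open_node_interval n x j"
    using open_open_node_interval zo by (meson openE)
  have "exp (- z) * poly (piece_slope j) z = 0"
  proof (rule DERIV_local_max[OF lebesgue_piece_has_derivative \<epsilon>(1)])
    show "\<forall>y. \<bar>z - y\<bar> < \<epsilon> \<longrightarrow> lebesgue_piece n x j y \<le> lebesgue_piece n x j z"
      using \<epsilon>(2) max open_node_interval_subset[OF j] by (auto simp: ball_def dist_real_def)
  qed
  then show "poly (piece_slope j) z = 0"
    by simp
qed

lemma max_point:
  assumes j: "1 \<le> j" "j \<le> n + 1"
  shows "max_point n x j \<in> open_node_interval n x j"
    and "poly (piece_slope j) (max_point n x j) = 0"
proof -
  let ?M = "is_arg_max (lebesgue_piece n x j) (\<lambda>t. t \<in> node_interval n x j)"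
  obtain z where z: "?M z"
    using lebesgue_piece_attains_max[OF j] by (metis is_arg_max_linorder)
  have "y = z" if "?M y" for y
    using max_point_interior[OF j z] max_point_interior[OF j that] critical_point_unique[OF j]
    by blast
  then have "?M (max_point n x j)"
    unfolding max_point_def using z by (metis theI)
  from max_point_interior[OF j this]
  show "max_point n x j \<in> open_node_interval n x j"
    and "poly (piece_slope j) (max_point n x j) = 0" .
qed

section \<open>Slopes at the maximum points of other pieces\<close>

text \<open>
  The sign pattern of \<open>P\<^sub>l\<close> alone does not exclude a wrong slope at a point of \<open>I\<^sub>j\<close>, since the
  extremum of \<open>P\<^sub>l\<close> near an end of \<open>I\<^sub>j\<close> may lie on either side of it. Adding a multiple of \<open>P\<^sub>j\<close>
  changes the value at \<open>z\<^sub>j\<close> but not the slope there, and \<open>\<nu>\<close> is chosen to make the value zero,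
  between the values at the two ends of \<open>I\<^sub>j\<close>.
\<close>

lemma piece_slope_sign_at_max_point:
  assumes j: "1 \<le> j" "j \<le> n + 1" and l: "1 \<le> l" "l \<le> n + 1" "l \<noteq> j"
  shows "0 < lebesgue_sign j l * poly (piece_slope l) (max_point n x j)"
proof (rule ccontr)
  assume "\<not> ?thesis"
  then have desc: "lebesgue_sign j l * poly (piece_slope l) (max_point n x j) \<le> 0"
    by simp
  define z where "z = max_point n x j"
  have z: "z \<in> open_node_interval n x j" "poly (piece_slope j) z = 0"
    unfolding z_def by (rule max_point[OF j])+
  \<comment> \<open>This makes \<open>P\<^sub>l + \<nu> P\<^sub>j\<close> vanish at \<open>z\<close>.\<close>
  define \<nu> where "\<nu> = - lebesgue_piece n x l z / lebesgue_piece n x j z"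
  define G where "G = smult 1 (piece_poly n x l) + smult \<nu> (piece_poly n x j)"
  define c where "c = 1 * lebesgue_sign (n + 1) l + \<nu> * lebesgue_sign (n + 1) j"
  define s where "s = lebesgue_sign j l"
  have pos: "1 \<le> lebesgue_piece n x j z"
    by (rule lebesgue_piece_ge_1[OF j z(1)])
  have \<nu>: "\<bar>\<nu>\<bar> \<le> 1"
    using abs_lebesgue_piece_le[OF j z(1), of l] pos by (simp add: \<nu>_def divide_le_eq_1)
  have Gz: "exp_poly G c z = 0"
  proof -
    have "exp_poly G c z = lebesgue_piece n x l z + \<nu> * lebesgue_piece n x j z"
      by (simp add: G_def c_def lebesgue_piece_exp_poly exp_poly_def algebra_simps)
    then show ?thesis
      using pos by (simp add: \<nu>_def)
  qed
  have val: "node_value n x G c m = lebesgue_sign m l + \<nu> * lebesgue_sign m j"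
    if "m \<le> n + 1" for m
    unfolding G_def c_def node_value_lincomb using piece_value[OF that, of j] piece_value[OF that, of l] by simp
  have s: "s * s = 1" "\<bar>s\<bar> = 1"
    by (simp_all add: s_def)
  have "\<bar>s * \<nu>\<bar> \<le> 1"
    using \<nu> s by (simp add: abs_mult)
  then have \<nu>s: "s * \<nu> \<le> 1" "- 1 \<le> s * \<nu>"
    by (simp_all add: abs_le_iff)
  have left: "node_value n x G c (j - 1) = - s + \<nu>"
    using j l val[of "j - 1"] lebesgue_sign_step[of j l]
    by (simp add: s_def lebesgue_sign_own del: One_nat_def)
  have right: "node_value n x G c j = s + \<nu>"
    using j val[of j] by (simp add: s_def lebesgue_sign_own)
  have slope_z: "s * poly (slope_poly G) z \<le> 0"
    using desc z(2) unfolding G_def slope_poly_lincomb by (simp add: z_def s_def)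
  obtain a where a: "a \<in> open_node_interval n x j" "a < z" "0 \<le> s * poly (slope_poly G) a"
    using slope_sign_left[OF z(1) j, of s G c] \<nu>s s
    by (auto simp: Gz left algebra_simps simp del: One_nat_def)
  obtain b where b: "b \<in> open_node_interval n x j" "z < b" "0 \<le> s * poly (slope_poly G) b"
    using slope_sign_right[of j z s G c] z(1) j \<nu>s s
    by (auto simp: Gz right algebra_simps open_node_interval_def)
  have "G = 0"
  proof (rule descent_in_other_interval_imp_0[OF _ j l _ a(1) b(1) a(2) b(2)])
    show "degree G \<le> n"
      unfolding G_def by (intro degree_lincomb degree_piece_poly)
    show "0 \<le> lebesgue_sign j l * poly (slope_poly G) a"
      "lebesgue_sign j l * poly (slope_poly G) z \<le> 0"
      "0 \<le> lebesgue_sign j l * poly (slope_poly G) b"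
      using a b slope_z by (simp_all add: s_def)
    fix m assume m: "m \<le> n + 1"
    have "\<bar>lebesgue_sign m l * (\<nu> * lebesgue_sign m j)\<bar> \<le> 1"
      using \<nu> by (simp add: abs_mult)
    then show "0 \<le> lebesgue_sign m l * node_value n x G c m"
      by (simp add: val[OF m] distrib_left)
  qed
  then have "node_value n x G c (j - 1) = node_value n x G c j"
    by (simp add: node_value_def exp_poly_def)
  then show False
    using left right s by simp
qed

lemma max_point_strict_mono: "strict_mono_on {..n} (\<lambda>a. max_point n x (Suc a))"
proof (rule strict_mono_onI)
  fix a b assume "a \<in> {..n}" "b \<in> {..n}" "a < b"
  then show "max_point n x (Suc a) < max_point n x (Suc b)"
    by (intro open_node_interval_less[OF max_point(1) max_point(1)]) auto
qed

definition slope_quotient :: "nat \<Rightarrow> real poly" where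
  "slope_quotient i = piece_slope i div [:- max_point n x i, 1:]"

lemma piece_slope_eq:
  assumes "1 \<le> i" "i \<le> n + 1"
  shows "piece_slope i = [:- max_point n x i, 1:] * slope_quotient i"
  unfolding slope_quotient_def
  by (rule dvd_mult_div_cancel[symmetric]) (use max_point(2)[OF assms] in \<open>simp add: poly_eq_0_iff_dvd\<close>)

lemma degree_slope_quotient:
  assumes i: "1 \<le> i" "i \<le> n + 1"
  shows "degree (slope_quotient i) < n"
proof -
  have "slope_quotient i \<noteq> 0"
    using piece_slope_eq[OF i] piece_poly_nonzero[OF i] by auto
  then have "degree (piece_slope i) = 1 + degree (slope_quotient i)"
    unfolding piece_slope_eq[OF i] by (subst degree_mult_eq) auto
  then show ?thesis
    using degree_slope_poly[OF degree_piece_poly[of n x i]] by simp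
qed

text \<open>
  Dividing by \<open>z\<^sub>j - z\<^sub>i\<close> cancels the phase shift of \<open>lebesgue_sign\<close> at the interval \<open>i\<close>.
\<close>

lemma slope_quotient_sign:
  assumes i: "1 \<le> i" "i \<le> n + 1" and j: "1 \<le> j" "j \<le> n + 1" and ij: "i \<noteq> j"
  shows "0 < (-1) ^ (i + j) * poly (slope_quotient i) (max_point n x j)"
proof -
  let ?z = "max_point n x"
  have "0 < lebesgue_sign j i * ((?z j - ?z i) * poly (slope_quotient i) (?z j))"
    using piece_slope_sign_at_max_point[OF j i ij] unfolding piece_slope_eq[OF i]
    by (simp add: algebra_simps)
  moreover have "?z i < ?z j" if "i < j"
    using that i j by (intro open_node_interval_less[OF max_point(1) max_point(1)]) auto
  moreover have "?z j < ?z i" if "j < i"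
    using that i j by (intro open_node_interval_less[OF max_point(1) max_point(1)]) auto
  ultimately show ?thesis
    using ij by (cases "i < j") (auto simp: lebesgue_sign_eq power_add zero_less_mult_iff
        mult_less_0_iff minus_one_power_iff split: if_splits)
qed

lemma Q_entry:
  assumes i: "1 \<le> i" "i \<le> n + 1" and j: "1 \<le> j" "j \<le> n"
  shows "deriv (lebesgue_piece n x i) (x j) / (x j - max_point n x i)
    = exp (- x j) * poly (slope_quotient i) (x j)"
proof -
  have "x j \<noteq> max_point n x i"
  proof (cases "j < i")
    case True
    then have "x j \<le> x (i - 1)"
      using i by (intro node_le) auto
    then show ?thesis
      using max_point(1)[OF i] by (auto simp: open_node_interval_def)
  next
    case False
    then have "x i \<le> x j" "i \<le> n"
      using j by (auto intro: node_le)
    then show ?thesis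
      using max_point(1)[OF i] by (auto simp: open_node_interval_def)
  qed
  moreover have "deriv (lebesgue_piece n x i) (x j) = exp (- x j) * poly (piece_slope i) (x j)"
    by (rule DERIV_imp_deriv[OF lebesgue_piece_has_derivative])
  ultimately show ?thesis
    unfolding piece_slope_eq[OF i] by (simp add: field_simps)
qed

end

section \<open>Independence of polynomials with alternating values\<close>

text \<open>
  Let \<open>b i j\<close> be the terms of the divided difference of \<open>\<rho> i\<close>, up to a sign for each row. The rows
  of \<open>b\<close> sum to zero and the off-diagonal entries are positive. At an index \<open>l\<close> where a solution
  \<open>y\<close> of the system without row and column \<open>k\<close> has a positive maximum \<open>M\<close>, the equation of row
  \<open>l\<close> reads \<open>\<Sum>j. b l j (y j - M) = b l k M\<close>, with a nonpositive left and a positive right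
  side.
\<close>

lemma sign_alternating_kernel_trivial:
  fixes \<rho> :: "nat \<Rightarrow> real poly" and \<zeta> u :: "nat \<Rightarrow> real"
  assumes mono: "strict_mono_on {..n} \<zeta>"
    and deg: "\<And>i. i \<le> n \<Longrightarrow> degree (\<rho> i) < n"
    and alt: "\<And>i j. i \<le> n \<Longrightarrow> j \<le> n \<Longrightarrow> i \<noteq> j \<Longrightarrow> 0 < (-1) ^ (i + j) * poly (\<rho> i) (\<zeta> j)"
    and k: "k \<le> n"
    and ker: "\<And>i. i \<le> n \<Longrightarrow> i \<noteq> k \<Longrightarrow> (\<Sum>j\<in>{..n} - {k}. poly (\<rho> i) (\<zeta> j) * u j) = 0"
    and m: "m \<le> n" "m \<noteq> k"
  shows "u m = 0"
proof -
  define w where "w j = (\<Prod>i\<in>{..n} - {j}. \<zeta> j - \<zeta> i)" for j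
  define b where "b i j = (-1) ^ (n + i) * (poly (\<rho> i) (\<zeta> j) / w j)" for i j
  have w: "0 < (-1) ^ (n + j) * w j" if "j \<le> n" for j
    unfolding w_def by (rule node_product_sign[OF mono that])
  have row_sum: "(\<Sum>j\<le>n. b i j) = 0" if i: "i \<le> n" for i
  proof -
    have "(\<Sum>j\<le>n. poly (\<rho> i) (\<zeta> j) / w j) = 0"
      unfolding w_def by (rule divided_difference_eq_0)
        (use strict_mono_on_imp_inj_on[OF mono] deg[OF i] in auto)
    then show ?thesis
      unfolding b_def sum_distrib_left[symmetric] by simp
  qed
  have off_diagonal: "0 < b i j" if ij: "i \<le> n" "j \<le> n" "i \<noteq> j" for i j
  proof -
    have "b i j = ((-1) ^ (i + j) * poly (\<rho> i) (\<zeta> j)) / ((-1) ^ (n + j) * w j)"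
      by (simp add: b_def minus_one_power_iff)
    then show ?thesis
      using alt[OF ij] w[OF ij(2)] by simp
  qed
  have no_positive: "y i \<le> 0"
    if y: "\<And>i. i \<in> {..n} - {k} \<Longrightarrow> (\<Sum>j\<in>{..n} - {k}. b i j * y j) = 0"
      and i: "i \<in> {..n} - {k}" for y i
  proof (rule ccontr)
    assume pos: "\<not> y i \<le> 0"
    define M where "M = Max (y ` ({..n} - {k}))"
    have M_ge: "y j \<le> M" if "j \<in> {..n} - {k}" for j
      unfolding M_def using that by (intro Max_ge) auto
    have "M \<in> y ` ({..n} - {k})"
      unfolding M_def using i by (intro Max_in) auto
    then obtain l where l: "l \<in> {..n} - {k}" "y l = M"
      by auto
    have "0 < M"
      using M_ge[OF i] pos by simp
    have "(\<Sum>j\<in>{..n} - {k}. b l j) = - b l k"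
      using row_sum[of l] l k by (simp add: sum.remove[of "{..n}" k])
    then have "(\<Sum>j\<in>{..n} - {k}. b l j * (y j - M)) = b l k * M"
      using y[OF l(1)] by (simp add: right_diff_distrib sum_subtractf flip: sum_distrib_right)
    moreover have "(\<Sum>j\<in>{..n} - {k}. b l j * (y j - M)) \<le> 0"
    proof (rule sum_nonpos)
      fix j assume j: "j \<in> {..n} - {k}"
      show "b l j * (y j - M) \<le> 0"
        using l j off_diagonal[of l j] M_ge[OF j]
        by (cases "j = l") (auto intro: mult_nonneg_nonpos)
    qed
    moreover have "0 < b l k * M"
      using off_diagonal[of l k] l k \<open>0 < M\<close> by simp
    ultimately show False
      by simp
  qed
  \<comment> \<open>The weights \<open>w j\<close> are absorbed into the solution; \<open>c = 1\<close> and \<open>c = -1\<close> give both bounds.\<close>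
  have sys: "(\<Sum>j\<in>{..n} - {k}. b i j * (c * (w j * u j))) = 0"
    if i: "i \<in> {..n} - {k}" for i c
  proof -
    have "(\<Sum>j\<in>{..n} - {k}. b i j * (c * (w j * u j)))
        = (\<Sum>j\<in>{..n} - {k}. (-1) ^ (n + i) * c * (poly (\<rho> i) (\<zeta> j) * u j))"
    proof (rule sum.cong[OF refl])
      fix j assume "j \<in> {..n} - {k}"
      then have "w j \<noteq> 0"
        using w[of j] by auto
      then show "b i j * (c * (w j * u j)) = (-1) ^ (n + i) * c * (poly (\<rho> i) (\<zeta> j) * u j)"
        by (simp add: b_def)
    qed
    also have "\<dots> = 0"
      using ker[of i] i by (simp flip: sum_distrib_left)
    finally show ?thesis .
  qed
  have "1 * (w m * u m) \<le> 0" "(-1) * (w m * u m) \<le> 0"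
    using no_positive[of "\<lambda>j. 1 * (w j * u j)" m] no_positive[of "\<lambda>j. (-1) * (w j * u j)" m]
      sys[where c = 1] sys[where c = "-1"] m by auto
  then have "w m * u m = 0"
    by simp
  then show ?thesis
    using w[OF m(1)] by auto
qed

lemma insert_index_bij:
  assumes "k \<le> n"
  shows "bij_betw (insert_index k) {..<n} ({..n} - {k})"
  using bij_betw_imageI[OF insert_index_inj_on insert_index_image[of k n]] assms
  by (simp add: atLeast0LessThan lessThan_Suc_atMost)

text \<open>
  A relation between the polynomials is a left kernel vector of the square matrix of their values
  at the points other than \<open>\<zeta> k\<close>, while the maximum principle concerns its right kernel; the
  determinant passes from one to the other.
\<close>

lemma sign_alternating_independent:
  fixes \<rho> :: "nat \<Rightarrow> real poly" and \<zeta> w :: "nat \<Rightarrow> real"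
  assumes mono: "strict_mono_on {..n} \<zeta>"
    and deg: "\<And>i. i \<le> n \<Longrightarrow> degree (\<rho> i) < n"
    and alt: "\<And>i j. i \<le> n \<Longrightarrow> j \<le> n \<Longrightarrow> i \<noteq> j \<Longrightarrow> 0 < (-1) ^ (i + j) * poly (\<rho> i) (\<zeta> j)"
    and k: "k \<le> n"
    and dep: "(\<Sum>a<n. smult (w a) (\<rho> (insert_index k a))) = 0"
    and a: "a < n"
  shows "w a = 0"
proof -
  define I where "I = insert_index k"
  note bij = insert_index_bij[OF k, folded I_def]
  define M where "M = mat n n (\<lambda>(a, b). poly (\<rho> (I a)) (\<zeta> (I b)))"
  have M: "M \<in> carrier_mat n n"
    by (simp add: M_def)
  have "det M \<noteq> 0"
  proof
    assume "det M = 0"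
    then obtain y where y: "y \<in> carrier_vec n" "y \<noteq> 0\<^sub>v n" "M *\<^sub>v y = 0\<^sub>v n"
      using det_0_iff_vec_prod_zero[OF M] by auto
    define u where "u j = y $ (inv_into {..<n} I j)" for j
    have uI: "u (I b) = y $ b" if "b < n" for b
      using that bij_betw_inv_into_left[OF bij, of b] by (simp add: u_def)
    have "u m = 0" if "m \<le> n" "m \<noteq> k" for m
    proof (rule sign_alternating_kernel_trivial[OF mono deg alt k _ that])
      fix i assume i: "i \<le> n" "i \<noteq> k"
      then obtain c where c: "c < n" "i = I c"
        using bij by (auto simp: bij_betw_def)
      have "(\<Sum>j\<in>{..n} - {k}. poly (\<rho> i) (\<zeta> j) * u j)
          = (\<Sum>b<n. poly (\<rho> i) (\<zeta> (I b)) * u (I b))"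
        by (rule sum.reindex_bij_betw[OF bij, symmetric])
      also have "\<dots> = (M *\<^sub>v y) $ c"
        using c y(1) uI by (simp add: M_def scalar_prod_def atLeast0LessThan)
      finally show "(\<Sum>j\<in>{..n} - {k}. poly (\<rho> i) (\<zeta> j) * u j) = 0"
        using y(3) c by simp
    qed
    then have "y $ b = 0" if "b < n" for b
      using uI[OF that] bij_betwE[OF bij] that by auto
    then show False
      using y(1,2) by (auto simp: vec_eq_iff)
  qed
  then have det: "det (transpose_mat M) \<noteq> 0"
    by (simp add: det_transpose[OF M])
  have "transpose_mat M *\<^sub>v vec n w = 0\<^sub>v n"
  proof (rule eq_vecI)
    fix b assume "b < dim_vec (0\<^sub>v n :: real vec)"
    then have "(transpose_mat M *\<^sub>v vec n w) $ b = (\<Sum>a<n. poly (\<rho> (I a)) (\<zeta> (I b)) * w a)"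
      by (simp add: M_def scalar_prod_def atLeast0LessThan)
    also have "\<dots> = poly (\<Sum>a<n. smult (w a) (\<rho> (I a))) (\<zeta> (I b))"
      by (simp add: poly_sum mult.commute)
    finally show "(transpose_mat M *\<^sub>v vec n w) $ b = (0\<^sub>v n :: real vec) $ b"
      using dep \<open>b < dim_vec (0\<^sub>v n :: real vec)\<close> by (simp add: I_def)
  qed (simp add: M_def)
  then have "vec n w = 0\<^sub>v n"
  proof (rule contrapos_pp)
    assume "vec n w \<noteq> 0\<^sub>v n"
    then show "transpose_mat M *\<^sub>v vec n w \<noteq> 0\<^sub>v n"
      using det det_0_iff_vec_prod_zero[of "transpose_mat M" n] M vec_carrier[of n w]
      by (metis transpose_carrier_mat)
  qed
  then show ?thesis
    using a by (metis index_vec index_zero_vec(1))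
qed

section \<open>Nonsingularity\<close>

lemma invertible_mat_of_trivial_left_kernel:
  fixes A :: "real mat"
  assumes A: "A \<in> carrier_mat n n"
    and ker: "\<And>w. (\<And>b. b < n \<Longrightarrow> (\<Sum>a<n. w a * A $$ (a, b)) = 0) \<Longrightarrow> (\<And>a. a < n \<Longrightarrow> w a = 0)"
  shows "invertible_mat A"
proof -
  have "det (transpose_mat A) \<noteq> 0"
  proof
    assume "det (transpose_mat A) = 0"
    then obtain y where y: "y \<in> carrier_vec n" "y \<noteq> 0\<^sub>v n" "transpose_mat A *\<^sub>v y = 0\<^sub>v n"
      using det_0_iff_vec_prod_zero[of "transpose_mat A" n] A by auto
    have "(\<Sum>a<n. y $ a * A $$ (a, b)) = 0" if b: "b < n" for b
    proof -
      have "(\<Sum>a<n. y $ a * A $$ (a, b)) = (transpose_mat A *\<^sub>v y) $ b"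
        using A y(1) b by (simp add: scalar_prod_def atLeast0LessThan mult.commute)
      then show ?thesis
        using y(3) b by simp
    qed
    then have "y $ a = 0" if "a < n" for a
      using ker[of "\<lambda>a. y $ a"] that by blast
    then show False
      using y(1,2) by (auto simp: vec_eq_iff)
  qed
  then have "det A \<noteq> 0"
    by (simp add: det_transpose[OF A])
  from det_non_zero_imp_unit[OF A this, of "()"] obtain B where
    "B \<in> carrier_mat n n" "B * A = 1\<^sub>m n" "A * B = 1\<^sub>m n"
    by (auto simp: Units_def ring_mat_def)
  then show ?thesis
    using A unfolding invertible_mat_def inverts_mat_def by (metis carrier_matD square_mat.simps)
qed

theorem corollary3:
  fixes n k :: nat and x :: "nat \<Rightarrow> real"
  assumes "n \<ge> 1" and "x \<in> node_simplex n" and "k \<in> {1..n+1}"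
  shows "invertible_mat (Q_matrix n x k)"
proof -
  interpret exp_nodes n x
    by unfold_locales (use assms in auto)
  define q where "q a = slope_quotient (Suc a)" for a
  have row_le: "insert_index (k - 1) a \<le> n" if "a < n" for a
    using that by (auto simp: insert_index_def)
  show ?thesis
  proof (rule invertible_mat_of_trivial_left_kernel)
    show "Q_matrix n x k \<in> carrier_mat n n"
      by (simp add: Q_matrix_def)
    fix w a
    assume ker: "\<And>b. b < n \<Longrightarrow> (\<Sum>a<n. w a * Q_matrix n x k $$ (a, b)) = 0" and a: "a < n"
    define s where "s = (\<Sum>a<n. smult (w a) (q (insert_index (k - 1) a)))"
    have root: "poly s (x (Suc b)) = 0" if b: "b < n" for b
    proof -
      have "(\<Sum>a<n. w a * Q_matrix n x k $$ (a, b)) = exp (- x (Suc b)) * poly s (x (Suc b))"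
        unfolding s_def poly_sum sum_distrib_left
        by (rule sum.cong) (use b row_le in \<open>auto simp: Q_matrix_def q_def Q_entry\<close>)
      then show ?thesis
        using ker[OF b] by simp
    qed
    have "s = 0"
    proof (rule poly_eqI_degree)
      have "degree s \<le> n - 1"
        unfolding s_def
      proof (rule degree_sum_le)
        fix a assume "a \<in> {..<n}"
        then have "degree (q (insert_index (k - 1) a)) \<le> n - 1"
          using degree_slope_quotient[of "Suc (insert_index (k - 1) a)"] row_le[of a]
          by (simp add: q_def)
        then show "degree (smult (w a) (q (insert_index (k - 1) a))) \<le> n - 1"
          by (rule order_trans[OF degree_smult_le])
      qed simp
      moreover have "card (x ` {1..n}) = n"
        by (subst card_image[OF inj_on_subset[OF node_inj]]) auto
      ultimately show "degree s < card (x ` {1..n})" "degree (0 :: real poly) < card (x ` {1..n})"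
        using n_pos by auto
      fix y assume "y \<in> x ` {1..n}"
      then obtain j where "1 \<le> j" "j \<le> n" "y = x j"
        by auto
      then show "poly s y = poly 0 y"
        using root[of "j - 1"] by simp
    qed
    show "w a = 0"
    proof (rule sign_alternating_independent[OF max_point_strict_mono])
      show "degree (q i) < n" if "i \<le> n" for i
        using degree_slope_quotient[of "Suc i"] that by (simp add: q_def)
      show "0 < (-1) ^ (i + j) * poly (q i) (max_point n x (Suc j))"
        if "i \<le> n" "j \<le> n" "i \<noteq> j" for i j
        using slope_quotient_sign[of "Suc i" "Suc j"] that by (simp add: q_def)
      show "k - 1 \<le> n"
        using assms(3) by auto
      show "(\<Sum>a<n. smult (w a) (q (insert_index (k - 1) a))) = 0"
        using \<open>s = 0\<close> by (simp add: s_def)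
    qed (fact a)
  qed
qed

end
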